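(* Let $\mathcal H_i,\mathcal H_o$ be finite-dimensional complex Hilbert spaces with fixed computational (orthonormal) bases, and let $\widetilde P_i:\mathcal L(\mathcal H_i)\to\mathcal L(\mathcal H_i)$ and $\widetilde P_o:\mathcal L(\mathcal H_o)\to\mathcal L(\mathcal H_o)$ be linear projective maps ($\widetilde P_i^2=\widetilde P_i$, $\widetilde P_o^2=\widetilde P_o$) that are self-adjoint and unital and commute with transposition (or conjugation). Define the linear spaces $$\mathcal S_i=\{W\in\mathcal L(\mathcal H_i):\widetilde P_i[W]=W\},\qquad\mathcal S_o=\{W'\in\mathcal L(\mathcal H_o):\widetilde P_o[W']=W'\}.$$ Then a linear map $\widetilde T_{io}:\mathcal L(\mathcal H_i)\to\mathcal L(\mathcal H_o)$ satisfies $\widetilde T_{io}[W]\in\mathcal S_o$ for all $W\in\mathcal S_i$ if and only if its Choi matrix $T_{io}$ satisfies $$T_{io}=T_{io}-(\widetilde P_i\otimes\widetilde{\mathbb 1}_o)[T_{io}]+(\widetilde P_i\otimes\widetilde P_o)[T_{io}]=:\widetilde P^{(\mathrm{ntr})}_{io}[T_{io}],$$ and $\widetilde P^{(\mathrm{ntr})}_{io}:\mathcal L(\mathcal H_i\otimes\mathcal H_o)\to\mathcal L(\mathcal H_i\otimes\mathcal H_o)$ is a self-adjoint, unital projector (idempotent linear map) that commutes with transposition.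
   Context: $\mathcal L(\mathcal H)$ is the space of linear operators on $\mathcal H$. The Choi matrix of $\widetilde T:\mathcal L(\mathcal H_i)\to\mathcal L(\mathcal H_o)$ is $T=\sum_{jk}|j\rangle\langle k|\otimes\widetilde T[|j\rangle\langle k|]\in\mathcal L(\mathcal H_i\otimes\mathcal H_o)$, with $\{|j\rangle\}$ the computational basis of $\mathcal H_i$. Adjoint: $\operatorname{tr}[B^\dagger\widetilde P[A]]=\operatorname{tr}[\widetilde P^\dagger[B]^\dagger A]$ for all $A,B$; self-adjoint: $\widetilde P=\widetilde P^\dagger$; unital: $\widetilde P[\mathbb 1]=\mathbb 1$; commuting with transposition (conjugation): $\widetilde P[W^\tau]=\widetilde P[W]^\tau$ ($\widetilde P[W^*]=\widetilde P[W]^*$) for all $W$, transposition $\tau$ and entrywise conjugation $*$ being taken in the (product) computational basis. $\widetilde{\mathbb 1}_o$ is the identity map on $\mathcal L(\mathcal H_o)$.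
   Formalization: Commuting with only transposition, or only conjugation, does not suffice: the equivalence is stated for P_i and P_o commuting with conjugation, and the claim that the projector commutes with transposition for P_i and P_o commuting with transposition. *)

theory Defs
  imports "HOL-Analysis.Analysis"
begin

text \<open>A finite-dimensional Hilbert space with a fixed computational basis indexed by
  \<open>'n\<close> is represented by \<open>complex^'n\<close>, and its space of linear operators by the matrices
  \<open>complex^'n^'n\<close>. The product basis of a tensor product is indexed by pairs, so operators
  on it are matrices over \<open>'i \<times> 'o\<close>.\<close>

definition cscale :: "complex \<Rightarrow> complex^'m^'n \<Rightarrow> complex^'m^'n" (infixr \<open>*\<^sub>M\<close> 75)
  where "c *\<^sub>M A = map_matrix (\<lambda>z. c * z) A"

abbreviation complex_linear :: "(complex^'a^'b \<Rightarrow> complex^'c^'d) \<Rightarrow> bool"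
  where "complex_linear \<equiv> Vector_Spaces.linear cscale cscale"

definition conj_matrix :: "complex^'m^'n \<Rightarrow> complex^'m^'n"
  where "conj_matrix A = map_matrix cnj A"

definition dagger :: "complex^'m^'n \<Rightarrow> complex^'n^'m"
  where "dagger A = transpose (conj_matrix A)"

definition matrix_unit :: "'n \<Rightarrow> 'm \<Rightarrow> complex^'m^'n"
  where "matrix_unit j k = (\<chi> a b. if a = j \<and> b = k then 1 else 0)"

definition kron :: "complex^'i^'i \<Rightarrow> complex^'o^'o \<Rightarrow> complex^('i \<times> 'o)^('i \<times> 'o)"
  where "kron A B = (\<chi> x y. A $ fst x $ fst y * B $ snd x $ snd y)"

definition choi :: "(complex^'i^'i \<Rightarrow> complex^'o^'o) \<Rightarrow> complex^('i \<times> 'o)^('i \<times> 'o)"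
  where "choi T = (\<Sum>j\<in>UNIV. \<Sum>k\<in>UNIV. kron (matrix_unit j k) (T (matrix_unit j k)))"

text \<open>The tensor product of two linear maps, obtained by expanding the argument in the product
  matrix units \<open>kron (matrix_unit j k) (matrix_unit l m)\<close>; \<open>tensor_map_kron\<close> and
  \<open>linear_tensor_map\<close> below confirm that it is the linear map with
  \<open>kron A B \<mapsto> kron (P A) (Q B)\<close>.\<close>

definition tensor_map ::
    "(complex^'i^'i \<Rightarrow> complex^'i^'i) \<Rightarrow> (complex^'o^'o \<Rightarrow> complex^'o^'o) \<Rightarrow>
     complex^('i \<times> 'o)^('i \<times> 'o) \<Rightarrow> complex^('i \<times> 'o)^('i \<times> 'o)"
  where "tensor_map P Q M =
    (\<Sum>j\<in>UNIV. \<Sum>k\<in>UNIV. \<Sum>l\<in>UNIV. \<Sum>m\<in>UNIV.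
       (M $ (j, l) $ (k, m)) *\<^sub>M kron (P (matrix_unit j k)) (Q (matrix_unit l m)))"

definition is_adjoint_map ::
    "(complex^'a^'a \<Rightarrow> complex^'b^'b) \<Rightarrow> (complex^'b^'b \<Rightarrow> complex^'a^'a) \<Rightarrow> bool"
  where "is_adjoint_map P P' \<longleftrightarrow>
    (\<forall>A B. trace (dagger B ** P A) = trace (dagger (P' B) ** A))"

definition self_adjoint_map :: "(complex^'n^'n \<Rightarrow> complex^'n^'n) \<Rightarrow> bool"
  where "self_adjoint_map P \<longleftrightarrow> is_adjoint_map P P"

definition unital_map :: "(complex^'n^'n \<Rightarrow> complex^'n^'n) \<Rightarrow> bool"
  where "unital_map P \<longleftrightarrow> P (mat 1) = mat 1"

definition projective_map :: "(complex^'n^'n \<Rightarrow> complex^'n^'n) \<Rightarrow> bool"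
  where "projective_map P \<longleftrightarrow> complex_linear P \<and> P \<circ> P = P"

definition commutes_with_transposition :: "(complex^'n^'n \<Rightarrow> complex^'n^'n) \<Rightarrow> bool"
  where "commutes_with_transposition P \<longleftrightarrow> (\<forall>W. P (transpose W) = transpose (P W))"

definition commutes_with_conjugation :: "(complex^'n^'n \<Rightarrow> complex^'n^'n) \<Rightarrow> bool"
  where "commutes_with_conjugation P \<longleftrightarrow> (\<forall>W. P (conj_matrix W) = conj_matrix (P W))"

definition fixed_space :: "(complex^'n^'n \<Rightarrow> complex^'n^'n) \<Rightarrow> (complex^'n^'n) set"
  where "fixed_space P = {W. P W = W}"

definition P_ntr ::
    "(complex^'i^'i \<Rightarrow> complex^'i^'i) \<Rightarrow> (complex^'o^'o \<Rightarrow> complex^'o^'o) \<Rightarrow>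
     complex^('i \<times> 'o)^('i \<times> 'o) \<Rightarrow> complex^('i \<times> 'o)^('i \<times> 'o)"
  where "P_ntr P\<^sub>i P\<^sub>o M = M - tensor_map P\<^sub>i id M + tensor_map P\<^sub>i P\<^sub>o M"

lemma cscale_nth [simp]: "(c *\<^sub>M A) $ i $ j = c * A $ i $ j"
  by (simp add: cscale_def)

lemma vector_space_cscale: "vector_space cscale"
  by unfold_locales (simp_all add: vec_eq_iff algebra_simps)

lemma complex_linear_iff:
  "complex_linear P \<longleftrightarrow> (\<forall>A B. P (A + B) = P A + P B) \<and> (\<forall>c A. P (c *\<^sub>M A) = c *\<^sub>M P A)"
  by (simp add: Vector_Spaces.linear_def module_hom_def module_hom_axioms_def
      vector_space_cscale module_iff_vector_space)

lemma times_matrix_unit: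
  "c * matrix_unit j k $ a $ b = (if a = j \<and> b = k then c else 0)"
  by (simp add: matrix_unit_def)

lemma sum_delta_pair:
  fixes f :: "'a::finite \<Rightarrow> 'b::finite \<Rightarrow> complex"
  shows "(\<Sum>x\<in>UNIV. \<Sum>y\<in>UNIV. if a = x \<and> b = y then f x y else 0) = f a b"
proof -
  have "(\<Sum>y\<in>UNIV. if a = x \<and> b = y then f x y else 0) = (if a = x then f x b else 0)" for x
    by (cases "a = x") simp_all
  then show ?thesis by simp
qed

lemma sum_delta_pair':
  fixes f :: "'a::finite \<Rightarrow> 'b::finite \<Rightarrow> complex"
  shows "(\<Sum>x\<in>UNIV. \<Sum>y\<in>UNIV. if y = b \<and> x = a then f x y else 0) = f a b"
  using sum_delta_pair[of a b f] by (simp add: eq_commute conj_commute)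

lemma complex_linear_expand:
  assumes "complex_linear P"
  shows "P A = (\<Sum>j\<in>UNIV. \<Sum>k\<in>UNIV. (A $ j $ k) *\<^sub>M P (matrix_unit j k))"
proof -
  interpret P: Vector_Spaces.linear cscale cscale P by (rule assms)
  have "A = (\<Sum>j\<in>UNIV. \<Sum>k\<in>UNIV. (A $ j $ k) *\<^sub>M matrix_unit j k)"
    by (simp add: vec_eq_iff times_matrix_unit sum_delta_pair)
  then have "P A = P (\<Sum>j\<in>UNIV. \<Sum>k\<in>UNIV. (A $ j $ k) *\<^sub>M matrix_unit j k)"
    by (rule arg_cong)
  then show ?thesis
    by (simp add: P.sum P.scale)
qed

lemma linear_tensor_map: "complex_linear (tensor_map P Q)"
  unfolding complex_linear_iff tensor_map_def
  by (simp add: vec_eq_iff distrib_right sum.distrib sum_distrib_left mult.assoc)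

lemma tensor_map_kron:
  assumes "complex_linear P" "complex_linear Q"
  shows "tensor_map P Q (kron A B) = kron (P A) (Q B)"
  unfolding complex_linear_expand [OF assms(1), of A] complex_linear_expand [OF assms(2), of B]
  by (simp add: tensor_map_def kron_def vec_eq_iff sum_distrib_right)
    (simp add: sum_distrib_left mult_ac)

text \<open>Adjoints are unique, so \<open>self_adjoint_map P\<close> says that \<open>P\<close> equals its adjoint.\<close>

lemma is_adjoint_map_unique:
  assumes "is_adjoint_map P Q" "is_adjoint_map P Q'"
  shows "Q = Q'"
proof
  fix B
  have eq: "trace (dagger (Q B) ** A) = trace (dagger (Q' B) ** A)" for A
    using assms unfolding is_adjoint_map_def by metis
  have entry: "trace (dagger X ** matrix_unit j k) = cnj (X $ j $ k)" for X :: "complex^'a^'a" and j k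
    by (simp add: trace_def matrix_matrix_mult_def dagger_def conj_matrix_def transpose_def
        times_matrix_unit sum_delta_pair')
  show "Q B = Q' B"
    using eq[of "matrix_unit _ _"] by (simp add: entry vec_eq_iff)
qed

text \<open>For maps that preserve Hermitian conjugation, commuting with transposition and commuting
  with entrywise conjugation are the same condition. Without that, they are independent even for
  self-adjoint unital projectors: the orthogonal projectors onto the spans of \<open>{1, A}\<close> and
  \<open>{1, E}\<close>, with \<open>A = (1, i; i, -1)\<close> and \<open>E = (0, 1; 0, 0)\<close>, satisfy only the first and only
  the second, respectively.\<close>

lemma commutes_with_transposition_iff_conjugation:
  assumes "\<And>W. P (dagger W) = dagger (P W)"
  shows "commutes_with_transposition P \<longleftrightarrow> commutes_with_conjugation P"
proof -
  have 1: "transpose (dagger W) = conj_matrix W" "dagger (transpose W) = conj_matrix W"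
    "conj_matrix (dagger W) = transpose W" "dagger (conj_matrix W) = transpose W"
    for W :: "complex^'a^'a"
    by (simp_all add: vec_eq_iff dagger_def transpose_def conj_matrix_def)
  show ?thesis
    unfolding commutes_with_transposition_def commutes_with_conjugation_def
    using assms 1 by metis
qed

end

theory Submission
  imports Defs
begin

text \<open>On Choi matrices, \<open>tensor_map P Q\<close> acts as \<open>T \<mapsto> Q \<circ> T \<circ> P\<^sup>t\<close>, where \<open>P\<^sup>t\<close> is the
  transpose of \<open>P\<close> in the basis of matrix units. A self-adjoint map that commutes with conjugation
  is real symmetric in that basis, so \<open>P\<^sup>t = P\<close> and the Choi condition says
  \<open>T \<circ> P\<^sub>i = P\<^sub>o \<circ> T \<circ> P\<^sub>i\<close>. The structural claims follow from those for \<open>tensor_map\<close>, as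
  product operators span, together with the fact that the range of \<open>P\<^sub>i \<otimes> P\<^sub>o\<close> is contained in
  that of \<open>P\<^sub>i \<otimes> 1\<close>.\<close>

section \<open>Kronecker products and entrywise conjugation\<close>

lemma kron_matrix_unit:
  "kron (matrix_unit j k) (matrix_unit l m) = matrix_unit (j, l) (k, m)"
  by (auto simp: kron_def matrix_unit_def vec_eq_iff)

lemma kron_mat_1: "kron (mat 1) (mat 1) = mat 1"
  by (auto simp: kron_def mat_def vec_eq_iff)

lemma transpose_kron: "transpose (kron A B) = kron (transpose A) (transpose B)"
  by (simp add: kron_def transpose_def vec_eq_iff)

lemma conj_matrix_kron: "conj_matrix (kron A B) = kron (conj_matrix A) (conj_matrix B)"
  by (simp add: kron_def conj_matrix_def vec_eq_iff)

lemma conj_matrix_conj_matrix [simp]: "conj_matrix (conj_matrix A) = A"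
  by (simp add: conj_matrix_def vec_eq_iff)

lemma conj_matrix_matrix_unit [simp]: "conj_matrix (matrix_unit j k) = matrix_unit j k"
  by (simp add: conj_matrix_def matrix_unit_def vec_eq_iff)

section \<open>Linear maps determined by their values on spanning sets\<close>

lemma linear_eq_on_matrix_unit:
  assumes "complex_linear F" "complex_linear G"
    and "\<And>j k. F (matrix_unit j k) = G (matrix_unit j k)"
  shows "F = G"
proof
  show "F A = G A" for A
    using assms(3) by (simp add: complex_linear_expand[OF assms(1), of A]
        complex_linear_expand[OF assms(2), of A])
qed

text \<open>The matrix units of the product basis are themselves product operators, so these span.
  Identities between tensor maps can thus be checked where \<open>tensor_map_kron\<close>
  applies.\<close>

lemma linear_eq_on_kron:
  assumes "complex_linear F" "complex_linear G"
    and "\<And>A B. F (kron A B) = G (kron A B)"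
  shows "F = G"
proof (rule linear_eq_on_matrix_unit[OF assms(1,2)])
  show "F (matrix_unit j k) = G (matrix_unit j k)" for j k
    using assms(3)[of "matrix_unit (fst j) (fst k)" "matrix_unit (snd j) (snd k)"]
    by (simp add: kron_matrix_unit)
qed

lemma complex_linear_id: "complex_linear (id :: complex^'m^'n \<Rightarrow> complex^'m^'n)"
  by (simp add: complex_linear_iff)

lemma complex_linear_comp:
  "complex_linear F \<Longrightarrow> complex_linear G \<Longrightarrow> complex_linear (F \<circ> G)"
  by (simp add: complex_linear_iff)

lemma complex_linear_transpose: "complex_linear (transpose :: complex^'m^'n \<Rightarrow> complex^'n^'m)"
  by (simp add: complex_linear_iff transpose_def vec_eq_iff)

lemma conj_matrix_add: "conj_matrix (A + B) = conj_matrix A + conj_matrix B"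
  by (simp add: conj_matrix_def vec_eq_iff)

lemma conj_matrix_cscale: "conj_matrix (c *\<^sub>M A) = cnj c *\<^sub>M conj_matrix A"
  by (simp add: conj_matrix_def vec_eq_iff)

text \<open>The two antilinear conjugations cancel. In this linear form, commuting with conjugation
  can be tested on product operators.\<close>

lemma complex_linear_conj_conjugate:
  assumes "complex_linear F"
  shows "complex_linear (\<lambda>A. conj_matrix (F (conj_matrix A)))"
  using assms by (simp add: complex_linear_iff conj_matrix_add conj_matrix_cscale)

section \<open>Self-adjointness in the basis of matrix units\<close>

lemma trace_dagger_mult:
  "trace (dagger B ** A) = (\<Sum>a\<in>UNIV. \<Sum>b\<in>UNIV. cnj (B $ a $ b) * A $ a $ b)"
  by (simp add: trace_def matrix_matrix_mult_def dagger_def conj_matrix_def transpose_def)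
    (rule sum.swap)

lemma sum_swap2:
  "(\<Sum>x\<in>X. \<Sum>c\<in>C. \<Sum>d\<in>D. g x c d) = (\<Sum>c\<in>C. \<Sum>d\<in>D. \<Sum>x\<in>X. g x c d)"
  by (subst sum.swap, rule sum.cong[OF refl], rule sum.swap)

lemma sum_swap_pairs:
  "(\<Sum>a\<in>A. \<Sum>b\<in>B. \<Sum>c\<in>C. \<Sum>d\<in>D. f a b c d) =
   (\<Sum>c\<in>C. \<Sum>d\<in>D. \<Sum>a\<in>A. \<Sum>b\<in>B. f a b c d)"
  unfolding sum_swap2[where X = B and C = C and D = D] by (rule sum_swap2)

text \<open>Matrix units are orthonormal for the trace inner product, so
  \<open>P (matrix_unit j k) $ a $ b\<close> is the entry of the matrix of \<open>P\<close> in row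
  \<open>(a, b)\<close> and column \<open>(j, k)\<close>. Self-adjointness means that this matrix is
  Hermitian.\<close>

lemma self_adjoint_map_iff_entries:
  fixes P :: "complex^'a^'a \<Rightarrow> complex^'a^'a"
  assumes "complex_linear P"
  shows "self_adjoint_map P \<longleftrightarrow>
    (\<forall>a b j k. P (matrix_unit j k) $ a $ b = cnj (P (matrix_unit a b) $ j $ k))"
proof
  assume P: "self_adjoint_map P"
  show "\<forall>a b j k. P (matrix_unit j k) $ a $ b = cnj (P (matrix_unit a b) $ j $ k)"
  proof (intro allI)
    fix a b j k
    \<comment> \<open>The collapse of \<open>sum_delta_pair\<close>, with the equations oriented as
      unfolding \<open>matrix_unit\<close> produces them.\<close>
    have delta: "(\<Sum>x\<in>UNIV. \<Sum>y\<in>UNIV. if x = a \<and> y = b then f x y else 0) = f a b"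
      for f :: "'a \<Rightarrow> 'a \<Rightarrow> complex" and a b
      using sum_delta_pair[of a b f] by (simp add: eq_commute)
    \<comment> \<open>Pairing with a matrix unit reads off an entry; the claim is the adjoint
      identity at \<open>A = matrix_unit j k\<close> and \<open>B = matrix_unit a b\<close>.\<close>
    have left: "trace (dagger (matrix_unit a b) ** X) = X $ a $ b"
      and right: "trace (dagger X ** matrix_unit a b) = cnj (X $ a $ b)"
      for X :: "complex^'a^'a" and a b
      by (simp_all add: trace_dagger_mult matrix_unit_def if_distrib[of cnj]
          if_distrib[of "\<lambda>x. x * _"] if_distrib[of "\<lambda>x. _ * x"] delta cong: if_cong)
    show "P (matrix_unit j k) $ a $ b = cnj (P (matrix_unit a b) $ j $ k)"
      using P unfolding self_adjoint_map_def is_adjoint_map_def by (metis left right)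
  qed
next
  assume entries: "\<forall>a b j k. P (matrix_unit j k) $ a $ b = cnj (P (matrix_unit a b) $ j $ k)"
  have "trace (dagger B ** P A) = trace (dagger (P B) ** A)" for A B
  proof -
    have "trace (dagger B ** P A) = (\<Sum>a\<in>UNIV. \<Sum>b\<in>UNIV. \<Sum>j\<in>UNIV. \<Sum>k\<in>UNIV.
        cnj (B $ a $ b) * (A $ j $ k * P (matrix_unit j k) $ a $ b))"
      by (simp add: trace_dagger_mult complex_linear_expand[OF assms, of A] sum_distrib_left)
    also have "\<dots> = (\<Sum>j\<in>UNIV. \<Sum>k\<in>UNIV. \<Sum>a\<in>UNIV. \<Sum>b\<in>UNIV.
        cnj (B $ a $ b) * (A $ j $ k * P (matrix_unit j k) $ a $ b))"
      by (rule sum_swap_pairs)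
    also have "\<dots> = (\<Sum>j\<in>UNIV. \<Sum>k\<in>UNIV. \<Sum>a\<in>UNIV. \<Sum>b\<in>UNIV.
        cnj (B $ a $ b) * (A $ j $ k * cnj (P (matrix_unit a b) $ j $ k)))"
      by (intro sum.cong refl arg_cong2[where f = "(*)"] entries[rule_format])
    also have "\<dots> = trace (dagger (P B) ** A)"
      by (simp add: trace_dagger_mult complex_linear_expand[OF assms, of B] sum_distrib_right
          sum_distrib_left mult_ac)
    finally show ?thesis .
  qed
  then show "self_adjoint_map P"
    by (simp add: self_adjoint_map_def is_adjoint_map_def)
qed

section \<open>Properties inherited by tensor products of maps\<close>

lemma tensor_map_matrix_unit:
  assumes "complex_linear P" "complex_linear Q"
  shows "tensor_map P Q (matrix_unit a b) =
    kron (P (matrix_unit (fst a) (fst b))) (Q (matrix_unit (snd a) (snd b)))"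
  using tensor_map_kron[OF assms, of "matrix_unit (fst a) (fst b)" "matrix_unit (snd a) (snd b)"]
  by (simp add: kron_matrix_unit)

text \<open>On product matrix units the entries factor into one of \<open>P\<close> and one of
  \<open>Q\<close>, so Hermitian symmetry holds factor by factor.\<close>

lemma self_adjoint_tensor_map:
  assumes "complex_linear P" "complex_linear Q" "self_adjoint_map P" "self_adjoint_map Q"
  shows "self_adjoint_map (tensor_map P Q)"
proof -
  have P: "P (matrix_unit j k) $ a $ b = cnj (P (matrix_unit a b) $ j $ k)"
    and Q: "Q (matrix_unit l m) $ c $ d = cnj (Q (matrix_unit c d) $ l $ m)" for a b c d j k l m
    using assms self_adjoint_map_iff_entries by blast+
  have "tensor_map P Q (matrix_unit (j, l) (k, m)) $ (a, c) $ (b, d) =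
      cnj (tensor_map P Q (matrix_unit (a, c) (b, d)) $ (j, l) $ (k, m))" for a b c d j k l m
    by (simp add: tensor_map_matrix_unit assms kron_def P[of j k] Q[of l m])
  then show ?thesis
    unfolding self_adjoint_map_iff_entries[OF linear_tensor_map] split_paired_All by blast
qed

lemma self_adjoint_map_id: "self_adjoint_map id"
  by (simp add: self_adjoint_map_def is_adjoint_map_def)

lemma tensor_map_comp:
  assumes "complex_linear P" "complex_linear Q" "complex_linear P'" "complex_linear Q'"
  shows "tensor_map P Q \<circ> tensor_map P' Q' = tensor_map (P \<circ> P') (Q \<circ> Q')"
  by (rule linear_eq_on_kron)
    (simp_all add: assms complex_linear_comp linear_tensor_map tensor_map_kron)

lemma unital_tensor_map:
  assumes "complex_linear P" "complex_linear Q" "unital_map P" "unital_map Q"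
  shows "unital_map (tensor_map P Q)"
  using assms tensor_map_kron[OF assms(1,2), of "mat 1" "mat 1"]
  by (simp add: unital_map_def kron_mat_1)

lemma commutes_with_transposition_tensor_map:
  assumes "complex_linear P" "complex_linear Q"
    and "commutes_with_transposition P" "commutes_with_transposition Q"
  shows "commutes_with_transposition (tensor_map P Q)"
proof -
  have "tensor_map P Q \<circ> transpose = transpose \<circ> tensor_map P Q"
    using assms(3,4)
    by (intro linear_eq_on_kron complex_linear_comp linear_tensor_map complex_linear_transpose)
      (simp add: transpose_kron tensor_map_kron assms(1,2) commutes_with_transposition_def)
  then show ?thesis
    by (simp add: commutes_with_transposition_def fun_eq_iff)
qed

lemma commutes_with_conjugation_tensor_map:
  assumes "complex_linear P" "complex_linear Q"
    and "commutes_with_conjugation P" "commutes_with_conjugation Q"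
  shows "commutes_with_conjugation (tensor_map P Q)"
proof -
  have "(\<lambda>M. conj_matrix (tensor_map P Q (conj_matrix M))) = tensor_map P Q"
    using assms(3,4)
    by (intro linear_eq_on_kron complex_linear_conj_conjugate linear_tensor_map)
      (simp add: conj_matrix_kron tensor_map_kron assms(1,2) commutes_with_conjugation_def)
  then show ?thesis
    unfolding commutes_with_conjugation_def by (metis conj_matrix_conj_matrix)
qed

section \<open>Choi matrices\<close>

lemma choi_entry: "choi T $ x $ y = T (matrix_unit (fst x) (fst y)) $ snd x $ snd y"
  by (simp add: choi_def kron_def matrix_unit_def if_distrib[of "\<lambda>x. x * _"] sum_delta_pair
      cong: if_cong)

lemma choi_eq_iff:
  assumes "complex_linear S" "complex_linear T"
  shows "choi S = choi T \<longleftrightarrow> S = T"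
proof
  assume eq: "choi S = choi T"
  have "S (matrix_unit j k) $ l $ m = T (matrix_unit j k) $ l $ m" for j k l m
    using choi_entry[of S "(j, l)" "(k, m)"] choi_entry[of T "(j, l)" "(k, m)"] eq by simp
  then show "S = T"
    using assms by (intro linear_eq_on_matrix_unit) (simp_all add: vec_eq_iff)
qed simp

text \<open>Matrix units are real, hence so are their images under \<open>P\<close>, and a Hermitian
  matrix with real entries is symmetric.\<close>

lemma matrix_unit_entries_symmetric:
  assumes "complex_linear P" "self_adjoint_map P" "commutes_with_conjugation P"
  shows "P (matrix_unit j k) $ a $ b = P (matrix_unit a b) $ j $ k"
proof -
  have "conj_matrix (P (matrix_unit a b)) = P (matrix_unit a b)"
    using assms(3) unfolding commutes_with_conjugation_def by (metis conj_matrix_matrix_unit)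
  then have "cnj (P (matrix_unit a b) $ j $ k) = P (matrix_unit a b) $ j $ k"
    by (simp add: conj_matrix_def vec_eq_iff)
  then show ?thesis
    using self_adjoint_map_iff_entries[OF assms(1)] assms(2) by metis
qed

lemma tensor_map_choi:
  assumes P: "complex_linear P" "self_adjoint_map P" "commutes_with_conjugation P"
    and Q: "complex_linear Q" and T: "complex_linear T"
  shows "tensor_map P Q (choi T) = choi (Q \<circ> T \<circ> P)"
proof -
  have "tensor_map P Q (choi T) $ (a, c) $ (b, d) = choi (Q \<circ> T \<circ> P) $ (a, c) $ (b, d)" for a b c d
  proof -
    \<comment> \<open>The sum over the output indices is the expansion of \<open>Q\<close> at
      \<open>T (matrix_unit j k)\<close>.\<close>
    have "tensor_map P Q (choi T) $ (a, c) $ (b, d) = (\<Sum>j\<in>UNIV. \<Sum>k\<in>UNIV.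
        P (matrix_unit j k) $ a $ b * Q (T (matrix_unit j k)) $ c $ d)"
      by (simp add: tensor_map_def choi_entry kron_def
          complex_linear_expand[OF Q, of "T _"] sum_distrib_left mult_ac)
    \<comment> \<open>By symmetry the coefficients become the entries of
      \<open>P (matrix_unit a b)\<close>, so that the sum expands \<open>Q \<circ> T\<close> at that
      matrix.\<close>
    also have "\<dots> = (\<Sum>j\<in>UNIV. \<Sum>k\<in>UNIV.
        P (matrix_unit a b) $ j $ k * (Q \<circ> T) (matrix_unit j k) $ c $ d)"
      by (simp add: matrix_unit_entries_symmetric[OF P, of _ _ a b])
    also have "\<dots> = (Q \<circ> T) (P (matrix_unit a b)) $ c $ d"
      by (simp add: complex_linear_expand[OF complex_linear_comp[OF Q T], of "P _"] del: o_apply)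
    finally show ?thesis by (simp add: choi_entry)
  qed
  then show ?thesis by (simp add: vec_eq_iff)
qed

text \<open>The fixed points of an idempotent \<open>P\<close> are exactly its values, so the
  condition on \<open>W\<close> can be stated for all \<open>P A\<close>.\<close>

lemma maps_fixed_space_iff:
  assumes "projective_map P"
  shows "(\<forall>W\<in>fixed_space P. T W \<in> fixed_space Q) \<longleftrightarrow> Q \<circ> T \<circ> P = T \<circ> P"
proof -
  have "P (P W) = P W" for W
    using assms by (metis comp_apply projective_map_def)
  then show ?thesis
    unfolding fixed_space_def fun_eq_iff by (simp, metis)
qed

text \<open>The two commutation conditions appear as separate premises because neither implies the
  other in general. Conjugation governs the Choi criterion, as it makes the matrix of
  \<open>P\<^sub>i\<close> real; each condition passes to \<open>P_ntr\<close> in its own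
  right.\<close>

theorem theorem4:
  fixes P\<^sub>i :: "complex^'i^'i \<Rightarrow> complex^'i^'i"
    and P\<^sub>o :: "complex^'o^'o \<Rightarrow> complex^'o^'o"
  assumes "projective_map P\<^sub>i" and "projective_map P\<^sub>o"
    and "self_adjoint_map P\<^sub>i" and "self_adjoint_map P\<^sub>o"
    and "unital_map P\<^sub>i" and "unital_map P\<^sub>o"
  shows
    "(commutes_with_conjugation P\<^sub>i \<and> commutes_with_conjugation P\<^sub>o \<longrightarrow>
        (\<forall>T :: complex^'i^'i \<Rightarrow> complex^'o^'o. complex_linear T \<longrightarrow>
           ((\<forall>W\<in>fixed_space P\<^sub>i. T W \<in> fixed_space P\<^sub>o) \<longleftrightarrow> choi T = P_ntr P\<^sub>i P\<^sub>o (choi T)))) \<and>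
     self_adjoint_map (P_ntr P\<^sub>i P\<^sub>o) \<and>
     unital_map (P_ntr P\<^sub>i P\<^sub>o) \<and>
     projective_map (P_ntr P\<^sub>i P\<^sub>o) \<and>
     (commutes_with_transposition P\<^sub>i \<and> commutes_with_transposition P\<^sub>o \<longrightarrow>
        commutes_with_transposition (P_ntr P\<^sub>i P\<^sub>o)) \<and>
     (commutes_with_conjugation P\<^sub>i \<and> commutes_with_conjugation P\<^sub>o \<longrightarrow>
        commutes_with_conjugation (P_ntr P\<^sub>i P\<^sub>o))"
proof -
  let ?R = "tensor_map P\<^sub>i (id :: complex^'o^'o \<Rightarrow> complex^'o^'o)" and ?S = "tensor_map P\<^sub>i P\<^sub>o"
  have linear [simp]: "complex_linear P\<^sub>i" "complex_linear P\<^sub>o"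
    and idem [simp]: "P\<^sub>i \<circ> P\<^sub>i = P\<^sub>i" "P\<^sub>o \<circ> P\<^sub>o = P\<^sub>o"
    using assms(1,2) by (simp_all add: projective_map_def)
  note [simp] = complex_linear_id linear_tensor_map
  have "choi T = P_ntr P\<^sub>i P\<^sub>o (choi T) \<longleftrightarrow> (\<forall>W\<in>fixed_space P\<^sub>i. T W \<in> fixed_space P\<^sub>o)"
    if "commutes_with_conjugation P\<^sub>i" and T: "complex_linear T"
    for T :: "complex^'i^'i \<Rightarrow> complex^'o^'o"
  proof -
    \<comment> \<open>Cancelling \<open>choi T\<close> leaves
      \<open>?R (choi T) = ?S (choi T)\<close>; \<open>tensor_map_choi\<close> rewrites both sides,
      with \<open>Q\<close> being \<open>id\<close> and \<open>P\<^sub>o\<close>.\<close>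
    have "choi T = P_ntr P\<^sub>i P\<^sub>o (choi T) \<longleftrightarrow> choi (P\<^sub>o \<circ> T \<circ> P\<^sub>i) = choi (T \<circ> P\<^sub>i)"
      using that assms(3) by (auto simp: P_ntr_def tensor_map_choi algebra_simps)
    also have "\<dots> \<longleftrightarrow> P\<^sub>o \<circ> T \<circ> P\<^sub>i = T \<circ> P\<^sub>i"
      by (simp add: choi_eq_iff complex_linear_comp T)
    finally show ?thesis
      by (simp add: maps_fixed_space_iff assms(1))
  qed
  moreover have "self_adjoint_map (P_ntr P\<^sub>i P\<^sub>o)"
  proof -
    have "self_adjoint_map ?R" "self_adjoint_map ?S"
      by (simp_all add: self_adjoint_tensor_map self_adjoint_map_id assms(3,4))
    moreover have "trace (dagger B ** (X - Y + Z)) =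
        trace (dagger B ** X) - trace (dagger B ** Y) + trace (dagger B ** Z)"
      "trace (dagger (X - Y + Z) ** B) =
        trace (dagger X ** B) - trace (dagger Y ** B) + trace (dagger Z ** B)"
      for B X Y Z :: "complex^('i \<times> 'o)^('i \<times> 'o)"
      by (simp_all add: trace_dagger_mult algebra_simps sum.distrib sum_subtractf)
    ultimately show ?thesis
      by (simp add: self_adjoint_map_def is_adjoint_map_def P_ntr_def)
  qed
  moreover have "unital_map (P_ntr P\<^sub>i P\<^sub>o)"
  proof -
    have "unital_map ?R" "unital_map ?S"
      using assms(5,6) by (auto intro!: unital_tensor_map) (simp add: unital_map_def)
    then show ?thesis
      by (simp add: unital_map_def P_ntr_def)
  qed
  moreover have "projective_map (P_ntr P\<^sub>i P\<^sub>o)"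
  proof -
    have add: "?R (A + B) = ?R A + ?R B" "?S (A + B) = ?S A + ?S B"
      and scale: "?R (c *\<^sub>M A) = c *\<^sub>M ?R A" "?S (c *\<^sub>M A) = c *\<^sub>M ?S A" for A B c
      using linear_tensor_map[of P\<^sub>i "id :: complex^'o^'o \<Rightarrow> complex^'o^'o"] linear_tensor_map[of P\<^sub>i P\<^sub>o]
      unfolding complex_linear_iff by blast+
    have diff: "?R (A - B) = ?R A - ?R B" "?S (A - B) = ?S A - ?S B" for A B
      using add[of "A - B" B] by (simp_all add: algebra_simps)
    \<comment> \<open>Both \<open>?R\<close> and \<open>?S\<close> send
      \<open>M - ?R M + ?S M\<close> to \<open>?S M\<close>, so in a second application of
      \<open>P_ntr\<close> the two correction terms cancel.\<close>
    have "?R \<circ> ?R = ?R" "?R \<circ> ?S = ?S" "?S \<circ> ?R = ?S" "?S \<circ> ?S = ?S"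
      by (simp_all add: tensor_map_comp)
    then have "?R (?R M) = ?R M" "?R (?S M) = ?S M" "?S (?R M) = ?S M" "?S (?S M) = ?S M" for M
      by (simp_all add: fun_eq_iff)
    then have "P_ntr P\<^sub>i P\<^sub>o \<circ> P_ntr P\<^sub>i P\<^sub>o = P_ntr P\<^sub>i P\<^sub>o"
      by (simp add: fun_eq_iff P_ntr_def add diff)
    moreover have "complex_linear (P_ntr P\<^sub>i P\<^sub>o)"
      unfolding complex_linear_iff P_ntr_def add scale by (simp add: vec_eq_iff algebra_simps)
    ultimately show ?thesis
      by (simp add: projective_map_def)
  qed
  moreover have "commutes_with_transposition (P_ntr P\<^sub>i P\<^sub>o)"
    if "commutes_with_transposition P\<^sub>i" "commutes_with_transposition P\<^sub>o"
  proof -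
    have "commutes_with_transposition ?R" "commutes_with_transposition ?S"
      using that
      by (auto intro!: commutes_with_transposition_tensor_map)
        (simp add: commutes_with_transposition_def)
    then show ?thesis
      by (simp add: commutes_with_transposition_def P_ntr_def) (simp add: transpose_def vec_eq_iff)
  qed
  moreover have "commutes_with_conjugation (P_ntr P\<^sub>i P\<^sub>o)"
    if "commutes_with_conjugation P\<^sub>i" "commutes_with_conjugation P\<^sub>o"
  proof -
    have "commutes_with_conjugation ?R" "commutes_with_conjugation ?S"
      using that
      by (auto intro!: commutes_with_conjugation_tensor_map)
        (simp add: commutes_with_conjugation_def)
    then show ?thesis
      by (simp add: commutes_with_conjugation_def P_ntr_def) (simp add: conj_matrix_def vec_eq_iff)
  qed
  ultimately show ?thesis
    by blast
qed

end
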